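(* Let $n$ be a positive integer and let $d$ be an even positive integer. If either $n\ge 2$ and $d\ge 6$, or $n\ge 3$ and $d\ge 4$, then the set $N^{SPQ}_{n,d}\setminus\Sigma^{SPQ}_{n,d}$ is nonempty; that is, there exists an SPQ polynomial in $n$ variables and of degree $d$ that is nonnegative but not a sum of squares.
   Context: All polynomials have real coefficients. A polynomial $p:\mathbb{R}^n\to\mathbb{R}$ is separable plus quadratic (SPQ) if $p(x)=s(x)+q(x)$, where $s(x)=\sum_{i=1}^n s_i(x_i)$ for some univariate polynomials $s_i:\mathbb{R}\to\mathbb{R}$ and $q(x)$ is a quadratic polynomial (degree at most $2$, not necessarily homogeneous). A polynomial is nonnegative if $p(x)\ge 0$ for all $x\in\mathbb{R}^n$, and a sum of squares (sos) if $p=\sum_{i=1}^m q_i^2$ for some polynomials $q_1,\dots,q_m$. $N^{SPQ}_{n,d}$ (resp. $\Sigma^{SPQ}_{n,d}$) denotes the set of nonnegative (resp. sos) SPQ polynomials in $n$ variables and of degree $d$. *)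

theory Defs
  imports Complex_Main "HOL-Library.Poly_Mapping" "HOL-Computational_Algebra.Polynomial"
begin

text \<open>
  Real polynomials in the variables \<open>x\<^sub>0, x\<^sub>1, \<dots>\<close>: finitely supported maps from monomials (finitely
  supported exponent vectors) to coefficients, with the convolution product of
  \<^theory>\<open>HOL-Library.Poly_Mapping\<close>. The \<open>n\<close> variables \<open>x\<^sub>1, \<dots>, x\<^sub>n\<close> of the mathematical text are
  indexed here by \<open>0, \<dots>, n - 1\<close>.
\<close>

type_synonym mpoly = "(nat \<Rightarrow>\<^sub>0 nat) \<Rightarrow>\<^sub>0 real"

definition mpolys :: "nat \<Rightarrow> mpoly set" where
  "mpolys n = {p. \<forall>m \<in> Poly_Mapping.keys p. Poly_Mapping.keys m \<subseteq> {..<n}}"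

definition monom_degree :: "(nat \<Rightarrow>\<^sub>0 nat) \<Rightarrow> nat" where
  "monom_degree m = (\<Sum>i \<in> Poly_Mapping.keys m. Poly_Mapping.lookup m i)"

text \<open>The zero polynomial gets total degree \<open>0\<close>, as for \<^const>\<open>degree\<close>.\<close>

definition total_degree :: "mpoly \<Rightarrow> nat" where
  "total_degree p = Max (insert 0 (monom_degree ` Poly_Mapping.keys p))"

text \<open>
  Points are functions on all of \<^typ>\<open>nat\<close>; for \<open>p \<in> mpolys n\<close> the value depends only on the
  coordinates \<open>x i\<close> with \<open>i < n\<close>, so ranging over all such functions amounts to ranging over
  \<open>\<real>\<^sup>n\<close>.
\<close>

definition mpoly_eval :: "mpoly \<Rightarrow> (nat \<Rightarrow> real) \<Rightarrow> real" where
  "mpoly_eval p x =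
    (\<Sum>m \<in> Poly_Mapping.keys p. Poly_Mapping.lookup p m *
      (\<Prod>i \<in> Poly_Mapping.keys m. x i ^ Poly_Mapping.lookup m i))"

text \<open>The univariate polynomial \<open>u\<close> read as a polynomial in the variable \<open>x\<^sub>i\<close>.\<close>

definition in_variable :: "nat \<Rightarrow> real poly \<Rightarrow> mpoly" where
  "in_variable i u =
    (\<Sum>k \<le> degree u. Poly_Mapping.single (Poly_Mapping.single i k) (coeff u k))"

definition spq :: "nat \<Rightarrow> mpoly \<Rightarrow> bool" where
  "spq n p \<longleftrightarrow> (\<exists>(s :: nat \<Rightarrow> real poly) q.
     q \<in> mpolys n \<and> total_degree q \<le> 2 \<and> p = (\<Sum>i<n. in_variable i (s i)) + q)"

definition nonneg_poly :: "mpoly \<Rightarrow> bool" where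
  "nonneg_poly p \<longleftrightarrow> (\<forall>x. mpoly_eval p x \<ge> 0)"

definition sos :: "nat \<Rightarrow> mpoly \<Rightarrow> bool" where
  "sos n p \<longleftrightarrow> (\<exists>(m :: nat) (q :: nat \<Rightarrow> mpoly).
     (\<forall>i<m. q i \<in> mpolys n) \<and> p = (\<Sum>i<m. (q i)\<^sup>2))"

definition N_SPQ :: "nat \<Rightarrow> nat \<Rightarrow> mpoly set" where
  "N_SPQ n d = {p \<in> mpolys n. spq n p \<and> total_degree p = d \<and> nonneg_poly p}"

definition Sigma_SPQ :: "nat \<Rightarrow> nat \<Rightarrow> mpoly set" where
  "Sigma_SPQ n d = {p \<in> mpolys n. spq n p \<and> total_degree p = d \<and> sos n p}"

end

theory Submission
  imports Defs "HOL-Analysis.Convex"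
begin

text \<open>
  Two variables, \<open>d \<ge> 6\<close>: take \<open>p = x\<^sup>4 - 4 y x + S\<close> with \<open>y = 1 + 3 w\<close>. Minimising over \<open>x\<close> shows that
  \<open>p\<close> is nonnegative iff \<open>S(w) \<ge> 3 y\<^bsup>4/3\<^esup>\<close>, whereas a sum of squares decomposition with summands
  \<open>\<alpha> x\<^sup>2 + \<beta> x + \<gamma>\<close> yields a polynomial \<open>\<tau>(w) = - \<Sum> \<alpha> \<gamma>\<close> such that \<open>\<tau> \<ge> 0\<close>, \<open>\<tau>\<^sup>2 \<le> S\<close> and
  \<open>(S - \<tau>\<^sup>2) \<tau> \<ge> 2 y\<^sup>2\<close>. If \<open>S\<close> has contact of order six with \<open>3 y\<^bsup>4/3\<^esup>\<close> at \<open>w = 0\<close>, these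
  conditions force \<open>\<tau> = y\<^bsup>2/3\<^esup> + O(w\<^sup>3) = 1 + 2 w - w\<^sup>2 + O(w\<^sup>3)\<close>. For \<open>S\<close> of degree six, \<open>\<tau>\<close> would be
  a quadratic with negative leading coefficient up to an odd cubic term, contradicting \<open>\<tau> \<ge> 0\<close>. Adding
  \<open>\<epsilon> w\<^sup>d\<close> to \<open>S\<close> reaches every even degree: for small \<open>\<epsilon>\<close> the bound \<open>\<tau>\<^sup>2 \<le> S\<close> makes the higher
  coefficients of \<open>\<tau>\<close> negligible.

  Three variables, \<open>d = 4\<close>: the polynomial
  \<open>x\<^sup>4 + y\<^sup>4 + z\<^sup>4 - 2 (x\<^sup>2 + y\<^sup>2 + z\<^sup>2) + 24 (x y + y z + x z) + 113\<close> is nonnegative and vanishes at the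
  permutations of \<open>\<plusminus>(2, 2, -3)\<close>. The summands of a decomposition vanish there too, and on
  the squares of such polynomials a linear functional of the top coefficients is nonnegative which is
  negative at \<open>x\<^sup>4 + y\<^sup>4 + z\<^sup>4\<close>.
\<close>

section \<open>Univariate polynomials\<close>

text \<open>Otherwise \<open>P * P - Q\<close> inherits the positive leading coefficient of
  \<open>P * P\<close> and is eventually positive. This bounds the degrees of the summands of a
  decomposition and of the multiplier.\<close>

lemma degree_le_if_square_le:
  fixes P Q :: "real poly"
  assumes "\<And>x. (poly P x)\<^sup>2 \<le> poly Q x"
  shows "2 * degree P \<le> degree Q"
proof (rule ccontr)
  assume "\<not> 2 * degree P \<le> degree Q"
  then have lt: "degree Q < 2 * degree P" by simp
  then have "P \<noteq> 0" by auto
  then have deg: "degree (P * P) = 2 * degree P" by (simp add: degree_mult_eq)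
  then have lt': "degree (- Q) < degree (P * P)" using lt by simp
  have "lead_coeff (P * P - Q) = lead_coeff (P * P)"
    using lead_coeff_add_le[OF lt'] degree_add_eq_right[OF lt'] by (simp add: add.commute)
  also have "\<dots> > 0" using \<open>P \<noteq> 0\<close> by (simp add: lead_coeff_mult not_square_less_zero order_less_le)
  finally obtain n where "\<And>x. x \<ge> n \<Longrightarrow> poly (P * P - Q) x > 0"
    using poly_pinfty_gt_lc by (metis order_less_le_trans)
  from this[of n] assms[of n] show False by (simp add: power2_eq_square)
qed

text \<open>By continuity; applied after dividing an inequality by an even power of the
  variable.\<close>

lemma poly_nonneg_at_0_if_punctured:
  fixes P :: "real poly"
  assumes "\<And>x. x \<noteq> 0 \<Longrightarrow> poly P x \<ge> 0"
  shows "poly P 0 \<ge> 0"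
proof -
  have "(poly P \<longlongrightarrow> poly P 0) (at 0)" using poly_isCont isContD by blast
  moreover have "\<forall>\<^sub>F x in at (0::real). 0 \<le> poly P x"
    using assms by (simp add: eventually_at_filter)
  ultimately show ?thesis by (rule tendsto_lowerbound) simp
qed

lemma poly_eq_pCons0_mult:
  fixes P :: "real poly"
  assumes "poly P 0 = 0"
  shows "\<exists>Q. P = [:0, 1:] * Q \<and> degree Q \<le> degree P"
proof -
  have "[:0, 1:] dvd P" using assms poly_eq_0_iff_dvd[of P 0] by simp
  then obtain Q where Q: "P = [:0, 1:] * Q" by (elim dvdE)
  have "degree Q \<le> degree P" unfolding Q by (cases "Q = 0") (auto simp: degree_mult_eq)
  with Q show ?thesis by blast
qed

text \<open>Values at \<open>N + 1\<close> nodes determine, hence bound, a polynomial of degree at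
  most \<open>N\<close>; the point is that \<open>K\<close> depends on \<open>N\<close> alone. The
  induction splits off the last node \<open>a\<close>: the quotient by \<open>x - a\<close> stays
  bounded at the other nodes, whose distance from \<open>a\<close> is at least 1.\<close>

lemma poly_bounded_by_nodes:
  "\<exists>K\<ge>0. \<forall>P M \<theta>. degree P \<le> N \<longrightarrow> (\<forall>j\<in>{1..N+1}. \<bar>poly P (real j)\<bar> \<le> M) \<longrightarrow>
     0 \<le> \<theta> \<longrightarrow> \<theta> \<le> 1 \<longrightarrow> \<bar>poly P \<theta>\<bar> \<le> K * M"
proof (induction N)
  case 0
  show ?case
  proof (intro exI[of _ 1] conjI allI impI)
    fix P :: "real poly" and M \<theta> :: real
    assume "degree P \<le> 0" and *: "\<forall>j\<in>{1..0+1}. \<bar>poly P (real j)\<bar> \<le> M"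
    then obtain c where "P = [:c:]" by (meson degree_eq_zeroE le_zero_eq)
    then show "\<bar>poly P \<theta>\<bar> \<le> 1 * M" using * by auto
  qed simp
next
  case (Suc N)
  then obtain K where K: "K \<ge> 0" and IH: "\<And>P M \<theta>. degree P \<le> N \<Longrightarrow>
      (\<And>j. j\<in>{1..N+1} \<Longrightarrow> \<bar>poly P (real j)\<bar> \<le> M) \<Longrightarrow> 0 \<le> \<theta> \<Longrightarrow> \<theta> \<le> 1 \<Longrightarrow> \<bar>poly P \<theta>\<bar> \<le> K * M"
    by metis
  define a where "a = real (N + 2)"
  show ?case
  proof (intro exI[of _ "1 + a * (K * 2)"] conjI allI impI)
    show "0 \<le> 1 + a * (K * 2)" using K by (simp add: a_def)
    fix P :: "real poly" and M \<theta> :: real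
    assume deg: "degree P \<le> Suc N" and M: "\<forall>j\<in>{1..Suc N+1}. \<bar>poly P (real j)\<bar> \<le> M"
      and \<theta>: "0 \<le> \<theta>" "\<theta> \<le> 1"
    have Ma: "\<bar>poly P a\<bar> \<le> M" using M[rule_format, of "N+2"] by (simp add: a_def)
    have "poly (P - [:poly P a:]) a = 0" by simp
    then have "[:-a, 1:] dvd P - [:poly P a:]" using poly_eq_0_iff_dvd by blast
    then obtain Q where Q: "P - [:poly P a:] = [:-a, 1:] * Q" by (elim dvdE)
    have PQ: "poly P x = poly P a + (x - a) * poly Q x" for x
    proof -
      have "poly (P - [:poly P a:]) x = (x - a) * poly Q x" unfolding Q by (simp add: algebra_simps)
      then show ?thesis by simp
    qed
    have "degree ([:-a, 1:] * Q) \<le> Suc N"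
      using deg unfolding Q[symmetric] by (intro degree_diff_le) auto
    then have "degree Q \<le> N"
      using degree_mult_eq[of "[:-a, 1:]" Q] by (cases "Q = 0") (auto simp del: mult_pCons_left)
    moreover have "\<bar>poly Q (real j)\<bar> \<le> 2 * M" if "j \<in> {1..N+1}" for j
    proof -
      have "1 * \<bar>poly Q (real j)\<bar> \<le> \<bar>real j - a\<bar> * \<bar>poly Q (real j)\<bar>"
        using that by (intro mult_right_mono) (auto simp: a_def)
      also have "\<dots> = \<bar>poly P (real j) - poly P a\<bar>" using PQ[of "real j"] by (simp add: abs_mult)
      also have "\<dots> \<le> M + M" using M[rule_format, of j] that Ma by auto
      finally show ?thesis by simp
    qed
    ultimately have "\<bar>poly Q \<theta>\<bar> \<le> K * (2 * M)" using IH \<theta> by blast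
    moreover have "\<bar>\<theta> - a\<bar> \<le> a" using \<theta> by (auto simp: a_def)
    ultimately have "\<bar>(\<theta> - a) * poly Q \<theta>\<bar> \<le> a * (K * (2 * M))"
      unfolding abs_mult by (intro mult_mono) (auto simp: a_def)
    then show "\<bar>poly P \<theta>\<bar> \<le> (1 + a * (K * 2)) * M" using PQ[of \<theta>] Ma by (simp add: algebra_simps)
  qed
qed

text \<open>With \<open>y = 1 + 3 * w\<close>, the inequality \<open>2 * y\<^sup>2 + \<tau>\<^sup>3 - 3 * y powr (4 / 3) * \<tau> \<ge> 0\<close> has the double
  zero \<open>\<tau> = y powr (2 / 3)\<close>. Since \<open>S\<close> exceeds \<open>3 * y powr (4 / 3)\<close> only by \<open>O(w\<^sup>6)\<close>, the polynomial \<open>\<tau>\<close> must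
  agree with \<open>y powr (2 / 3) = 1 + 2 * w - w\<^sup>2 + O(w\<^sup>3)\<close> up to order two.\<close>

lemma contact_expansion:
  fixes S B \<tau> :: "real poly"
  assumes S: "\<And>w. poly S w = 3 + 12*w + 6*w^2 - 4*w^3 + 5*w^4 - 8*w^5 + w^6 * poly B w"
    and nonneg: "\<And>w. poly \<tau> w \<ge> 0"
    and ineq: "\<And>w. (poly S w - (poly \<tau> w)^2) * poly \<tau> w \<ge> 2 * (1 + 3*w)^2"
  shows "\<exists>\<delta>. degree \<delta> \<le> max (degree \<tau>) 2 \<and> (\<forall>w. poly \<tau> w = 1 + 2*w - w^2 + w^3 * poly \<delta> w)"
proof -
  \<comment> \<open>\<open>T\<close> is the quadratic Taylor polynomial of
    \<open>y powr (2 / 3)\<close>. The inequality is expanded in powers of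
    \<open>\<tau> - T\<close>, with \<open>w^6 * A = (S - T^2) * T - 2 * y^2\<close> and
    \<open>w^3 * C = S - 3 * T^2\<close>.\<close>
  define T :: "real poly" where "T = [:1, 2, -1:]"
  define A where "A = [:-20, 8:] + B * T"
  define C where "C = [:8, 2, -8:] + monom 1 3 * B"
  define X where "X = monom (1::real) 1"
  have X: "poly X w = w" for w by (simp add: X_def poly_monom)
  have T: "poly T w = 1 + 2*w - w^2" for w by (simp add: T_def algebra_simps power2_eq_square)
  have A: "poly A w = -20 + 8*w + poly B w * (1 + 2*w - w^2)" for w
    by (simp add: A_def T algebra_simps)
  have C: "poly C w = 8 + 2*w - 8*w^2 + w^3 * poly B w" for w
    by (simp add: C_def poly_monom algebra_simps power2_eq_square)
  define \<delta>0 where "\<delta>0 = \<tau> - T"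
  have deg0: "degree \<delta>0 \<le> max (degree \<tau>) 2"
    unfolding \<delta>0_def by (rule order_trans[OF degree_diff_le_max]) (auto simp: T_def)
  have \<tau>0: "poly \<tau> w = 1 + 2*w - w^2 + poly \<delta>0 w" for w by (simp add: \<delta>0_def T)
  have main: "w^6 * poly A w + poly \<delta>0 w * (w^3 * poly C w) - 3 * poly T w * (poly \<delta>0 w)^2 - (poly \<delta>0 w)^3 \<ge> 0" for w
  proof -
    have "w^6 * poly A w + poly \<delta>0 w * (w^3 * poly C w) - 3 * poly T w * (poly \<delta>0 w)^2 - (poly \<delta>0 w)^3
       = (poly S w - (poly \<tau> w)^2) * poly \<tau> w - 2 * (1 + 3*w)^2"
      unfolding S \<tau>0 A C T by algebra
    then show ?thesis using ineq[of w] by simp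
  qed
  have "poly \<delta>0 0 = 0"
  proof -
    let ?c = "poly \<delta>0 0"
    have 1: "1 + ?c \<ge> 0" using nonneg[of 0] \<tau>0[of 0] by simp
    have "?c^2 * (3 + ?c) \<le> 0" using main[of 0] T[of 0] by (simp add: algebra_simps power2_eq_square power3_eq_cube)
    then show ?thesis using 1 by (auto simp: mult_le_0_iff)
  qed
  then obtain \<delta>1 where \<delta>1: "\<delta>0 = [:0, 1:] * \<delta>1" and deg1: "degree \<delta>1 \<le> degree \<delta>0"
    using poly_eq_pCons0_mult by blast
  \<comment> \<open>The left side of \<open>main\<close> divided by \<open>w^2\<close>; at 0 only
    \<open>- 3 * T * \<delta>1^2\<close> survives, so \<open>\<delta>1\<close> vanishes there.
    \<open>Q2\<close> repeats this with \<open>w^4\<close>.\<close>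
  define Q1 where "Q1 = X^4 * A + X^2 * \<delta>1 * C - 3 * T * \<delta>1^2 - X * \<delta>1^3"
  have "poly Q1 w \<ge> 0" if "w \<noteq> 0" for w
  proof -
    have "w^2 * poly Q1 w = w^6 * poly A w + poly \<delta>0 w * (w^3 * poly C w) - 3 * poly T w * (poly \<delta>0 w)^2 - (poly \<delta>0 w)^3"
      unfolding Q1_def \<delta>1 by (simp add: X) algebra
    then have "w^2 * poly Q1 w \<ge> 0" using main[of w] by simp
    then show ?thesis using that by (simp add: zero_le_mult_iff)
  qed
  then have "poly Q1 0 \<ge> 0" by (rule poly_nonneg_at_0_if_punctured)
  then have "poly \<delta>1 0 = 0" by (simp add: Q1_def X T)
  then obtain \<delta>2 where \<delta>2: "\<delta>1 = [:0, 1:] * \<delta>2" and deg2: "degree \<delta>2 \<le> degree \<delta>1"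
    using poly_eq_pCons0_mult by blast
  define Q2 where "Q2 = X^2 * A + X * \<delta>2 * C - 3 * T * \<delta>2^2 - X^2 * \<delta>2^3"
  have "poly Q2 w \<ge> 0" if "w \<noteq> 0" for w
  proof -
    have "w^4 * poly Q2 w = w^6 * poly A w + poly \<delta>0 w * (w^3 * poly C w) - 3 * poly T w * (poly \<delta>0 w)^2 - (poly \<delta>0 w)^3"
      unfolding Q2_def \<delta>1 \<delta>2 by (simp add: X) algebra
    then have "w^4 * poly Q2 w \<ge> 0" using main[of w] by simp
    then show ?thesis using that by (simp add: zero_le_mult_iff)
  qed
  then have "poly Q2 0 \<ge> 0" by (rule poly_nonneg_at_0_if_punctured)
  then have "poly \<delta>2 0 = 0" by (simp add: Q2_def X T)
  then obtain \<delta>3 where \<delta>3: "\<delta>2 = [:0, 1:] * \<delta>3" and deg3: "degree \<delta>3 \<le> degree \<delta>2"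
    using poly_eq_pCons0_mult by blast
  have "degree \<delta>3 \<le> max (degree \<tau>) 2" using deg0 deg1 deg2 deg3 by linarith
  moreover have "poly \<tau> w = 1 + 2*w - w^2 + w^3 * poly \<delta>3 w" for w
    unfolding \<tau>0 \<delta>1 \<delta>2 \<delta>3 by (simp add: power3_eq_cube)
  ultimately show ?thesis by blast
qed

text \<open>Up to order five, \<open>sextic w\<close> is the Taylor expansion of \<open>3 * (1 + 3 * w) powr (4 / 3)\<close> at
  \<open>0\<close>. The leading coefficient only has to be large; the sum of the absolute values of all the
  coefficients, increased by \<open>1\<close>, is \<open>828\<^sup>2\<close>.\<close>

definition sextic :: "real \<Rightarrow> real" where
  "sextic w = 3 + 12*w + 6*w^2 - 4*w^3 + 5*w^4 - 8*w^5 + 685545*w^6"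

text \<open>With \<open>y = a^3\<close> the fractional power becomes \<open>a^4\<close>, and contact
  of order six makes the difference divisible by \<open>(a - 1)^6\<close>. Up to the factor 243 the
  cofactor is \<open>228515 * q^6 - E\<close>, where \<open>228515 = 685545 / 3\<close>.\<close>

lemma sextic_ge:
  fixes a :: real
  shows "sextic ((a^3 - 1) / 3) \<ge> 3 * a^4"
proof -
  define q where "q = a^2 + a + 1"
  define E where "E = 22 + 132*a + 462*a^2 + 792*a^3 + 861*a^4 + 678*a^5 + 393*a^6 + 168*a^7 + 48*a^8 + 8*a^9"
  have pow: "a^j \<le> (1 + a^2)^6" if "j \<le> 12" for j
  proof (cases "\<bar>a\<bar> \<le> 1")
    case True
    have "a^j \<le> \<bar>a\<bar>^j" by (metis abs_ge_self power_abs)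
    also have "\<dots> \<le> 1" using True by (simp add: power_le_one)
    also have "\<dots> \<le> (1 + a^2)^6" by (simp add: one_le_power)
    finally show ?thesis .
  next
    case False
    have "a^j \<le> \<bar>a\<bar>^j" by (metis abs_ge_self power_abs)
    also have "\<dots> \<le> \<bar>a\<bar>^12" using False that by (intro power_increasing) auto
    also have "\<dots> = (a^2)^6" by (simp flip: power_mult)
    also have "\<dots> \<le> (1 + a^2)^6" by (intro power_mono) auto
    finally show ?thesis .
  qed
  have "1 \<le> (1 + a^2)^6" "a \<le> (1 + a^2)^6" using pow[of 0] pow[of 1] by simp_all
  \<comment> \<open>\<open>3564\<close> is the sum of the coefficients of \<open>E\<close>, and
    \<open>228096 = 64 * 3564\<close> comes from \<open>q >= (1 + a^2) / 2\<close>.\<close>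
  then have "E \<le> 3564 * (1 + a^2)^6"
    using pow[of 2] pow[of 3] pow[of 4] pow[of 5] pow[of 6] pow[of 7] pow[of 8] pow[of 9]
    unfolding E_def by linarith
  also have "\<dots> = 228096 * ((1 + a^2) / 2)^6" by (simp add: power_divide)
  also have "\<dots> \<le> 228096 * q^6"
  proof -
    have "q - (1 + a^2) / 2 = (a + 1)^2 / 2" by (simp add: q_def power2_eq_square algebra_simps)
    then have "(1 + a^2) / 2 \<le> q" by (smt (verit) zero_le_power2 divide_nonneg_pos)
    then show ?thesis by (intro mult_left_mono power_mono) auto
  qed
  also have "\<dots> \<le> 228515 * q^6" by (simp add: mult_right_mono)
  finally have E: "E \<le> 228515 * q^6" .
  define v where "v = (a^3 - 1) / 3"
  have "3 * v = a^3 - 1" by (simp add: v_def)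
  also have "\<dots> = (a - 1) * q" unfolding q_def by algebra
  finally have v: "3 * v = (a - 1) * q" .
  have "243 * (3 + 12*v + 6*v^2 - 4*v^3 + 5*v^4 - 8*v^5 - 3*a^4) =
     729 + 972*(3*v) + 162*(3*v)^2 - 36*(3*v)^3 + 15*(3*v)^4 - 8*(3*v)^5 - 729*a^4"
    by (simp add: power_mult_distrib)
  also have "\<dots> = - ((a-1)^6 * E)"
    unfolding v q_def E_def by algebra
  finally have 1: "243 * (3 + 12*v + 6*v^2 - 4*v^3 + 5*v^4 - 8*v^5 - 3*a^4) = - ((a-1)^6 * E)" .
  have 2: "729 * v^6 = (a-1)^6 * q^6" using arg_cong[OF v, of "\<lambda>z. z^6"] by (simp add: power_mult_distrib)
  have "243 * (sextic v - 3*a^4) = (a-1)^6 * (228515 * q^6 - E)"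
    unfolding sextic_def using 1 2 by (simp add: algebra_simps)
  also have "\<dots> \<ge> 0" using E by (intro mult_nonneg_nonneg) auto
  finally show ?thesis by (simp add: v_def)
qed

text \<open>For fixed \<open>w\<close> the minimum over \<open>x\<close> is at the real cube root
  \<open>a\<close> of \<open>1 + 3 * w\<close>, where \<open>sextic_ge\<close> applies.\<close>

lemma bivariate_nonneg:
  fixes x w :: real
  shows "x^4 - 4*x*(1 + 3*w) + sextic w \<ge> 0"
proof -
  define a where "a = root 3 (1 + 3*w)"
  have a: "a^3 = 1 + 3*w" by (simp add: a_def odd_real_root_pow)
  have "0 \<le> (x - a)^2 * ((x + a)^2 + 2 * a^2)" by simp
  also have "\<dots> = x^4 - 4*x*a^3 + 3*a^4" by algebra
  also have "\<dots> \<le> x^4 - 4*x*(1 + 3*w) + sextic w" using sextic_ge[of a] a by simp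
  finally show ?thesis .
qed

text \<open>By \<open>contact_expansion\<close>,
  \<open>\<tau>(w) + \<tau>(-w) = 2 - 2 * w^2 + w^4 * \<rho>(w)\<close>. Nonnegativity at
  \<open>w = 2\<close> forces \<open>\<rho>(2) >= 3 / 8\<close>, whereas the upper bound on
  \<open>\<tau>^2\<close> makes \<open>\<rho>\<close> small on a distant interval, and interpolation
  carries this smallness back to 2.\<close>

lemma no_polynomial_multiplier:
  fixes d :: nat
  shows "\<exists>\<epsilon>>0. \<not> (\<exists>\<tau>::real poly. degree \<tau> \<le> d \<and> (\<forall>w. poly \<tau> w \<ge> 0 \<and>
     (poly \<tau> w)^2 \<le> sextic w + \<epsilon> * w^(6+e) \<and>
     (sextic w + \<epsilon> * w^(6+e) - (poly \<tau> w)^2) * poly \<tau> w \<ge> 2 * (1 + 3*w)^2))"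
proof -
  define N where "N = max d 2"
  obtain K where K: "K \<ge> 0" and bound: "\<And>P M \<theta>. degree P \<le> N \<Longrightarrow>
      (\<And>j. j\<in>{1..N+1} \<Longrightarrow> \<bar>poly P (real j)\<bar> \<le> M) \<Longrightarrow> 0 \<le> \<theta> \<Longrightarrow> \<theta> \<le> 1 \<Longrightarrow> \<bar>poly P \<theta>\<bar> \<le> K * M"
    using poly_bounded_by_nodes[of N] by metis
  \<comment> \<open>\<open>R\<close> makes \<open>K * (1660 / R) < 3 / 8\<close>, \<open>L\<close>
    covers the scaled nodes \<open>R * j\<close>, and \<open>\<epsilon>\<close> keeps
    \<open>\<epsilon> * \<bar>w\<bar>^e\<close> at most 1 up to \<open>L\<close>.\<close>
  define R where "R = 5000 * (K + 1)"
  have R: "R \<ge> 2" using K by (simp add: R_def)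
  define L where "L = R * real (N + 1)"
  have L: "L > 0" using R by (simp add: L_def)
  define \<epsilon> where "\<epsilon> = 1 / L^e"
  have \<epsilon>: "\<epsilon> > 0" using L by (simp add: \<epsilon>_def)
  show ?thesis
  proof (intro exI[of _ \<epsilon>] conjI notI \<epsilon>)
    assume "\<exists>\<tau>::real poly. degree \<tau> \<le> d \<and> (\<forall>w. poly \<tau> w \<ge> 0 \<and>
     (poly \<tau> w)^2 \<le> sextic w + \<epsilon> * w^(6+e) \<and>
     (sextic w + \<epsilon> * w^(6+e) - (poly \<tau> w)^2) * poly \<tau> w \<ge> 2 * (1 + 3*w)^2)"
    then obtain \<tau> :: "real poly" where deg: "degree \<tau> \<le> d" and nonneg: "\<And>w. poly \<tau> w \<ge> 0"
      and upper: "\<And>w. (poly \<tau> w)^2 \<le> sextic w + \<epsilon> * w^(6+e)"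
      and ineq: "\<And>w. (sextic w + \<epsilon> * w^(6+e) - (poly \<tau> w)^2) * poly \<tau> w \<ge> 2 * (1 + 3*w)^2"
      by blast
    define B where "B = [:685545:] + monom \<epsilon> e"
    define S where "S = [:3, 12, 6, -4, 5, -8:] + monom 1 6 * B"
    have S1: "poly S w = 3 + 12*w + 6*w^2 - 4*w^3 + 5*w^4 - 8*w^5 + w^6 * poly B w" for w
      by (simp add: S_def poly_monom algebra_simps power_numeral_reduce)
    have S2: "poly S w = sextic w + \<epsilon> * w^(6+e)" for w
      by (simp add: S1 sextic_def B_def poly_monom algebra_simps power_add)
    obtain \<delta> where deg\<delta>: "degree \<delta> \<le> max (degree \<tau>) 2"
      and \<tau>: "\<And>w. poly \<tau> w = 1 + 2*w - w^2 + w^3 * poly \<delta> w"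
      using contact_expansion[OF S1 nonneg] ineq unfolding S2 by blast
    \<comment> \<open>Twice the odd part of \<open>\<delta>\<close>, hence divisible by
      \<open>w\<close>; the even part of \<open>\<delta>\<close> cancels in
      \<open>\<tau>(w) + \<tau>(-w)\<close>.\<close>
    define g where "g = \<delta> - pcompose \<delta> [:0, -1:]"
    have g: "poly g w = poly \<delta> w - poly \<delta> (-w)" for w by (simp add: g_def poly_pcompose)
    have "degree g \<le> N"
      using deg\<delta> deg unfolding g_def N_def by (intro degree_diff_le) (auto simp: degree_pcompose)
    moreover have "poly g 0 = 0" by (simp add: g)
    ultimately obtain \<rho> where "g = [:0, 1:] * \<rho>" and deg\<rho>: "degree \<rho> \<le> N"
      using poly_eq_pCons0_mult[of g] by force
    then have \<rho>: "poly g w = w * poly \<rho> w" for w by simp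
    have even_part: "poly \<tau> w + poly \<tau> (-w) = 2 - 2*w^2 + w^4 * poly \<rho> w" for w
    proof -
      have "poly \<tau> w + poly \<tau> (-w) = 2 - 2*w^2 + w^3 * poly g w"
        unfolding \<tau> g by (simp add: algebra_simps)
      then show ?thesis unfolding \<rho> by (simp add: power_numeral_reduce)
    qed
    have \<rho>2: "poly \<rho> 2 \<ge> 3 / 8" using even_part[of 2] nonneg[of 2] nonneg[of "-2"] by simp
    have \<tau>_le: "poly \<tau> w \<le> 828 * \<bar>w\<bar>^3" if w: "1 \<le> \<bar>w\<bar>" "\<bar>w\<bar> \<le> L" for w
    proof -
      let ?u = "\<bar>w\<bar>"
      have pow: "w^j \<le> ?u^6" "- (w^j) \<le> ?u^6" if "j \<le> 6" for j
      proof -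
        have "?u^j \<le> ?u^6" using w that by (intro power_increasing) auto
        moreover have "\<bar>w^j\<bar> = ?u^j" by (simp add: power_abs)
        ultimately show "w^j \<le> ?u^6" "- (w^j) \<le> ?u^6" by linarith+
      qed
      have "\<epsilon> * w^(6+e) \<le> ?u^6"
      proof -
        have "\<bar>w^e\<bar> \<le> L^e" using w by (simp add: power_abs power_mono)
        then have "\<epsilon> * w^e \<le> 1" using L by (simp add: \<epsilon>_def)
        then have "\<epsilon> * w^e * w^6 \<le> 1 * w^6" by (intro mult_right_mono) auto
        then show ?thesis by (simp add: power_add mult_ac)
      qed
      then have "sextic w + \<epsilon> * w^(6+e) \<le> 685584 * ?u^6"
        using pow[of 0] pow[of 1] pow[of 2] pow[of 3] pow[of 4] pow[of 5] pow[of 6]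
        unfolding sextic_def by simp
      also have "\<dots> = (828 * ?u^3)^2" by (simp add: power_mult_distrib flip: power_mult)
      finally show ?thesis using upper[of w] power2_le_imp_le[of "poly \<tau> w" "828 * ?u^3"] by simp
    qed
    have \<rho>_le: "\<bar>poly \<rho> w\<bar> \<le> 1660 / R" if w: "w \<ge> R" "w \<le> L" for w
    proof -
      have w1: "w \<ge> 1" using w R by simp
      have "\<bar>w^4 * poly \<rho> w\<bar> \<le> 1656 * w^3 + 2 + 2 * w^2"
        using even_part[of w] \<tau>_le[of w] \<tau>_le[of "-w"] nonneg[of w] nonneg[of "-w"] w w1
        by (smt (verit) zero_le_power2 zero_le_power)
      also have "\<dots> \<le> 1660 * w^3"
        using power_increasing[of 2 3 w] one_le_power[of w 3] w1 by linarith
      finally have "w^3 * (w * \<bar>poly \<rho> w\<bar>) \<le> w^3 * 1660"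
        using w1 by (simp add: abs_mult power_numeral_reduce mult_ac)
      then have "w * \<bar>poly \<rho> w\<bar> \<le> 1660" using w1 by simp
      moreover have "R * \<bar>poly \<rho> w\<bar> \<le> w * \<bar>poly \<rho> w\<bar>" using w by (intro mult_right_mono) auto
      ultimately show ?thesis using R by (simp add: field_simps)
    qed
    \<comment> \<open>Rescaling puts the nodes at \<open>R * j\<close>, inside
      \<open>[R, L]\<close>, and turns the point 2 into \<open>2 / R\<close>, inside
      \<open>[0, 1]\<close>.\<close>
    define P where "P = pcompose \<rho> [:0, R:]"
    have P: "poly P x = poly \<rho> (R * x)" for x by (simp add: P_def poly_pcompose mult.commute)
    have "degree P \<le> N" using deg\<rho> R by (simp add: P_def degree_pcompose)
    moreover have "\<bar>poly P (real j)\<bar> \<le> 1660 / R" if "j \<in> {1..N+1}" for j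
      unfolding P using that R by (intro \<rho>_le) (auto simp: L_def mult_left_mono)
    ultimately have "\<bar>poly P (2 / R)\<bar> \<le> K * (1660 / R)" using R by (intro bound) auto
    then have "poly \<rho> 2 \<le> K * (1660 / R)" unfolding P using R by simp
    also have "\<dots> < 3 / 8" using K by (simp add: R_def field_simps)
    finally show False using \<rho>2 by simp
  qed
qed

section \<open>Evaluation of multivariate polynomials\<close>

definition mono_eval :: "(nat \<Rightarrow>\<^sub>0 nat) \<Rightarrow> (nat \<Rightarrow> real) \<Rightarrow> real" where
  "mono_eval m x = (\<Prod>i \<in> Poly_Mapping.keys m. x i ^ Poly_Mapping.lookup m i)"

lemma mono_eval_superset:
  assumes "finite A" "Poly_Mapping.keys m \<subseteq> A"
  shows "mono_eval m x = (\<Prod>i\<in>A. x i ^ Poly_Mapping.lookup m i)"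
  unfolding mono_eval_def using assms
  by (intro prod.mono_neutral_left) (auto simp: in_keys_iff)

lemma mono_eval_0 [simp]: "mono_eval 0 x = 1"
  by (simp add: mono_eval_def)

lemma mono_eval_single [simp]: "mono_eval (Poly_Mapping.single i k) x = x i ^ k"
  by (simp add: mono_eval_def)

lemma mono_eval_add: "mono_eval (m + m') x = mono_eval m x * mono_eval m' x"
proof -
  let ?A = "Poly_Mapping.keys m \<union> Poly_Mapping.keys m'"
  have "mono_eval (m + m') x = (\<Prod>i\<in>?A. x i ^ Poly_Mapping.lookup (m + m') i)"
    by (intro mono_eval_superset) (simp_all add: keys_add)
  also have "\<dots> = mono_eval m x * mono_eval m' x"
    by (simp add: lookup_add power_add prod.distrib mono_eval_superset[of ?A])
  finally show ?thesis .
qed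

lemma mpoly_eval_alt:
  "mpoly_eval p x = (\<Sum>m \<in> Poly_Mapping.keys p. Poly_Mapping.lookup p m * mono_eval m x)"
  by (simp add: mpoly_eval_def mono_eval_def)

lemma mpoly_eval_0 [simp]: "mpoly_eval 0 x = 0"
  by (simp add: mpoly_eval_alt)

lemma mpoly_eval_single [simp]: "mpoly_eval (Poly_Mapping.single m c) x = c * mono_eval m x"
  by (simp add: mpoly_eval_alt)

lemma mpoly_eval_add: "mpoly_eval (p + q) x = mpoly_eval p x + mpoly_eval q x"
  unfolding mpoly_eval_alt
  by (rule setsum_keys_plus_distrib) (auto simp: algebra_simps)

lemma mpoly_eval_sum: "mpoly_eval (sum f A) x = (\<Sum>i\<in>A. mpoly_eval (f i) x)"
  by (induction A rule: infinite_finite_induct) (auto simp: mpoly_eval_add)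

lemma sum_singles: "p = (\<Sum>m\<in>Poly_Mapping.keys p. Poly_Mapping.single m (Poly_Mapping.lookup p m))"
  by (rule poly_mapping_eqI) (auto simp: lookup_sum lookup_single when_def in_keys_iff)

lemma mpoly_eval_mult: "mpoly_eval (p * q) x = mpoly_eval p x * mpoly_eval q x"
proof -
  have "p * q = (\<Sum>m\<in>Poly_Mapping.keys p. \<Sum>m'\<in>Poly_Mapping.keys q.
     Poly_Mapping.single (m + m') (Poly_Mapping.lookup p m * Poly_Mapping.lookup q m'))"
    by (subst (1) sum_singles[of p], subst (1) sum_singles[of q]) (simp add: sum_product mult_single)
  then show ?thesis
    by (simp add: mpoly_eval_sum mono_eval_add sum_product mpoly_eval_alt[of p] mpoly_eval_alt[of q] mult_ac)
qed

lemma mpoly_eval_sos: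
  "mpoly_eval (\<Sum>i<m. (q i)\<^sup>2) x = (\<Sum>i<m. (mpoly_eval (q i) x)\<^sup>2)"
  by (simp add: mpoly_eval_sum mpoly_eval_mult power2_eq_square)

lemma mpoly_eval_line_poly:
  "\<exists>P :: real poly. \<forall>r. mpoly_eval q (\<lambda>i. a i + r * b i) = poly P r"
proof (intro exI allI)
  fix r
  show "mpoly_eval q (\<lambda>i. a i + r * b i) = poly (\<Sum>m \<in> Poly_Mapping.keys q.
      [:Poly_Mapping.lookup q m:] * (\<Prod>i \<in> Poly_Mapping.keys m. [:a i, b i:] ^ Poly_Mapping.lookup m i)) r"
    by (simp add: mpoly_eval_def poly_sum poly_prod)
qed

lemma mono_eval_scale: "mono_eval m (\<lambda>i. r * x i) = r ^ monom_degree m * mono_eval m x"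
  by (simp add: mono_eval_def monom_degree_def power_mult_distrib prod.distrib power_sum)

text \<open>Written out so that the coefficient of degree \<open>k\<close> is visibly the
  homogeneous part of degree \<open>k\<close> of \<open>q\<close> at \<open>x\<close>.\<close>

lemma mpoly_eval_scale:
  "mpoly_eval q (\<lambda>i. r * x i) = poly (\<Sum>m \<in> Poly_Mapping.keys q.
     monom (Poly_Mapping.lookup q m * mono_eval m x) (monom_degree m)) r"
  by (simp add: mpoly_eval_alt mono_eval_scale poly_sum poly_monom mult_ac)

lemma monom_degree_superset:
  assumes "finite A" "Poly_Mapping.keys m \<subseteq> A"
  shows "monom_degree m = (\<Sum>i\<in>A. Poly_Mapping.lookup m i)"
  unfolding monom_degree_def using assms
  by (intro sum.mono_neutral_left) (auto simp: in_keys_iff)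

lemma monom_degree_single [simp]: "monom_degree (Poly_Mapping.single i k) = k"
  by (simp add: monom_degree_def)

lemma monom_degree_add: "monom_degree (m + m') = monom_degree m + monom_degree m'"
proof -
  let ?A = "Poly_Mapping.keys m \<union> Poly_Mapping.keys m'"
  have "monom_degree (m + m') = (\<Sum>i\<in>?A. Poly_Mapping.lookup (m + m') i)"
    by (intro monom_degree_superset) (simp_all add: keys_add)
  also have "\<dots> = monom_degree m + monom_degree m'"
    by (simp add: lookup_add sum.distrib monom_degree_superset[of ?A])
  finally show ?thesis .
qed

lemma split_variable:
  fixes m :: "nat \<Rightarrow>\<^sub>0 nat"
  assumes "m \<noteq> 0"
  shows "\<exists>i m'. m = Poly_Mapping.single i 1 + m'"
proof -
  obtain i where i: "i \<in> Poly_Mapping.keys m" using assms by (metis keys_eq_empty ex_in_conv)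
  have "m = Poly_Mapping.single i 1 + (m - Poly_Mapping.single i 1)"
    using i by (intro poly_mapping_eqI) (auto simp: lookup_add lookup_minus lookup_single when_def in_keys_iff)
  then show ?thesis by blast
qed

lemma mono_eval_degree_2:
  assumes "monom_degree m = 2"
  shows "\<exists>i j. \<forall>x. mono_eval m x = x i * x j"
proof -
  have "m \<noteq> 0" using assms by (auto simp: monom_degree_def)
  then obtain i m' where m: "m = Poly_Mapping.single i 1 + m'" using split_variable by blast
  then have m'1: "monom_degree m' = 1" using assms by (simp add: monom_degree_add)
  then have "m' \<noteq> 0" by (auto simp: monom_degree_def)
  then obtain j m'' where m': "m' = Poly_Mapping.single j 1 + m''" using split_variable by blast
  have "m'' = 0"
  proof (rule ccontr)
    assume "m'' \<noteq> 0"
    then obtain k l where "m'' = Poly_Mapping.single k 1 + l" using split_variable by blast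
    then show False using m'1 m' by (simp add: monom_degree_add)
  qed
  then have "\<forall>x. mono_eval m x = x i * x j" by (simp add: m m' mono_eval_add)
  then show ?thesis by blast
qed

lemma total_degree_le_iff:
  "total_degree p \<le> d \<longleftrightarrow> (\<forall>m\<in>Poly_Mapping.keys p. monom_degree m \<le> d)"
  by (simp add: total_degree_def)

lemma mpolys_add: "p \<in> mpolys n \<Longrightarrow> q \<in> mpolys n \<Longrightarrow> p + q \<in> mpolys n"
  using keys_add[of p q] unfolding mpolys_def by blast

lemma total_degree_add_le: "total_degree p \<le> d \<Longrightarrow> total_degree q \<le> d \<Longrightarrow> total_degree (p + q) \<le> d"
  using keys_add[of p q] unfolding total_degree_le_iff by blast

section \<open>Assembling SPQ polynomials\<close>

definition product_term :: "nat \<Rightarrow> nat \<Rightarrow> real \<Rightarrow> mpoly" where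
  "product_term i j c = Poly_Mapping.single (Poly_Mapping.single i 1 + Poly_Mapping.single j 1) c"

lemma product_term_mpolys: "i < n \<Longrightarrow> j < n \<Longrightarrow> product_term i j c \<in> mpolys n"
  using keys_add[of "Poly_Mapping.single i 1" "Poly_Mapping.single j (1::nat)"]
  by (auto simp: mpolys_def product_term_def dest!: subsetD)

lemma total_degree_product_term: "total_degree (product_term i j c) \<le> 2"
  by (simp add: product_term_def total_degree_le_iff monom_degree_add)

lemma mpoly_eval_product_term: "mpoly_eval (product_term i j c) x = c * (x i * x j)"
  by (simp add: product_term_def mono_eval_add)

lemma mpoly_eval_in_variable: "mpoly_eval (in_variable i u) x = poly u (x i)"
  by (simp add: in_variable_def mpoly_eval_sum poly_altdef)

lemma keys_in_variable: "Poly_Mapping.keys (in_variable i u) \<subseteq> Poly_Mapping.single i ` {..degree u}"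
  unfolding in_variable_def by (rule order_trans[OF keys_sum]) (auto split: if_splits)

text \<open>For \<open>k = 0\<close> all variables share the same constant monomial.\<close>

lemma lookup_in_variable:
  assumes "k > 0"
  shows "Poly_Mapping.lookup (in_variable i u) (Poly_Mapping.single j k) = (if i = j then coeff u k else 0)"
proof -
  have *: "Poly_Mapping.single i l = Poly_Mapping.single j k \<longleftrightarrow> i = j \<and> l = k" for l
    using assms by (metis lookup_single_eq lookup_single_not_eq neq0_conv)
  show ?thesis
    by (auto simp: in_variable_def lookup_sum lookup_single when_def * coeff_eq_0 not_le)
qed

text \<open>Since \<open>d > 2\<close>, the quadratic part cannot cancel the \<open>d\<close>-th
  power of the variable \<open>j\<close>, so the degree is exactly \<open>d\<close>.\<close>

lemma spq_construction:
  assumes q: "q \<in> mpolys n" "total_degree q \<le> 2"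
    and d: "d > 2" and s: "\<And>i. i < n \<Longrightarrow> degree (s i) \<le> d" and j: "j < n" "degree (s j) = d"
    and p: "p = (\<Sum>i<n. in_variable i (s i)) + q"
  shows "p \<in> mpolys n" "spq n p" "total_degree p = d"
    "mpoly_eval p x = (\<Sum>i<n. poly (s i) (x i)) + mpoly_eval q x"
proof -
  have keys: "Poly_Mapping.keys p \<subseteq> (\<Union>i<n. Poly_Mapping.single i ` {..degree (s i)}) \<union> Poly_Mapping.keys q"
    unfolding p using keys_sum[of "\<lambda>i. in_variable i (s i)" "{..<n}"] keys_in_variable
    by (intro order_trans[OF keys_add] Un_mono order_trans[OF keys_sum] UN_mono) auto
  have "Poly_Mapping.keys m \<subseteq> {..<n}" if "m \<in> Poly_Mapping.keys p" for m
    using keys that q(1) unfolding mpolys_def by (auto 4 3 split: if_splits)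
  then show "p \<in> mpolys n" unfolding mpolys_def by blast
  show "spq n p" unfolding spq_def using p q by blast
  have "monom_degree m \<le> d" if "m \<in> Poly_Mapping.keys p" for m
    using keys that s q(2) d unfolding total_degree_le_iff by fastforce
  then have le: "total_degree p \<le> d" by (simp add: total_degree_le_iff)
  have "Poly_Mapping.single j d \<notin> Poly_Mapping.keys q"
    using q(2) d unfolding total_degree_le_iff by fastforce
  then have "Poly_Mapping.lookup p (Poly_Mapping.single j d) = coeff (s j) d"
    using j d by (simp add: p lookup_add lookup_sum lookup_in_variable in_keys_iff)
  also have "\<dots> \<noteq> 0" using j d by force
  finally have "Poly_Mapping.single j d \<in> Poly_Mapping.keys p" by (simp add: in_keys_iff)
  then have "total_degree p \<ge> d" using total_degree_le_iff[of p "total_degree p"] by fastforce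
  with le show "total_degree p = d" by simp
  show "mpoly_eval p x = (\<Sum>i<n. poly (s i) (x i)) + mpoly_eval q x"
    by (simp add: p mpoly_eval_add mpoly_eval_sum mpoly_eval_in_variable)
qed

section \<open>Two variables\<close>

lemma poly_degree_2:
  fixes P :: "real poly"
  assumes "degree P \<le> 2"
  shows "poly P x = coeff P 0 + coeff P 1 * x + coeff P 2 * x^2"
proof -
  have "poly P x = (\<Sum>i\<le>2. coeff P i * x^i)"
    unfolding poly_altdef using assms by (intro sum.mono_neutral_left) (auto simp: coeff_eq_0)
  then show ?thesis by (simp add: numeral_2_eq_2)
qed

text \<open>The coefficients are fixed combinations of values at 0, 1 and -1, so in two variables
  they depend polynomially on the other variable.\<close>

lemma degree_2_interpolation:
  fixes P :: "real poly"
  assumes "degree P \<le> 2"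
  shows "poly P x = poly P 0 + (poly P 1 - poly P (-1)) / 2 * x
    + (poly P 1 + poly P (-1) - 2 * poly P 0) / 2 * x^2"
proof -
  note * = poly_degree_2[OF assms]
  show ?thesis unfolding *[of x] *[of 1] *[of "-1"] *[of 0] by (simp add: field_simps)
qed

lemma quartic_sum_of_squares_coeffs:
  fixes \<alpha> \<beta> \<gamma> :: "'a \<Rightarrow> real"
  assumes "\<And>x. (\<Sum>i\<in>I. (\<gamma> i + \<beta> i * x + \<alpha> i * x^2)^2) = x^4 - b * x + c"
  shows "(\<Sum>i\<in>I. (\<alpha> i)^2) = 1" "(\<Sum>i\<in>I. \<alpha> i * \<beta> i) = 0"
    "(\<Sum>i\<in>I. (\<beta> i)^2) = - 2 * (\<Sum>i\<in>I. \<alpha> i * \<gamma> i)"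
    "2 * (\<Sum>i\<in>I. \<beta> i * \<gamma> i) = - b" "(\<Sum>i\<in>I. (\<gamma> i)^2) = c"
proof -
  have "(\<Sum>i\<in>I. (\<alpha> i)^2) * x^4 + 2 * (\<Sum>i\<in>I. \<alpha> i * \<beta> i) * x^3
      + ((\<Sum>i\<in>I. (\<beta> i)^2) + 2 * (\<Sum>i\<in>I. \<alpha> i * \<gamma> i)) * x^2
      + 2 * (\<Sum>i\<in>I. \<beta> i * \<gamma> i) * x + (\<Sum>i\<in>I. (\<gamma> i)^2) = x^4 - b * x + c" for x
    unfolding assms[of x, symmetric] sum_distrib_left sum_distrib_right sum.distrib[symmetric]
    by (intro sum.cong refl) algebra
  \<comment> \<open>Five points determine polynomials of degree at most four in
    \<open>x\<close>.\<close>
  from this[of 0] this[of 1] this[of "-1"] this[of 2] this[of "-2"]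
  show "(\<Sum>i\<in>I. (\<alpha> i)^2) = 1" "(\<Sum>i\<in>I. \<alpha> i * \<beta> i) = 0"
    "(\<Sum>i\<in>I. (\<beta> i)^2) = - 2 * (\<Sum>i\<in>I. \<alpha> i * \<gamma> i)"
    "2 * (\<Sum>i\<in>I. \<beta> i * \<gamma> i) = - b" "(\<Sum>i\<in>I. (\<gamma> i)^2) = c"
    by simp_all
qed

text \<open>Read \<open>\<alpha>\<close>, \<open>\<beta>\<close>, \<open>\<gamma>\<close> as
  vectors: \<open>\<alpha>\<close> is a unit vector orthogonal to \<open>\<beta>\<close>, and
  \<open>\<gamma> + \<tau> * \<alpha>\<close> is the part of \<open>\<gamma>\<close> orthogonal to
  \<open>\<alpha>\<close>. It has squared length \<open>c - \<tau>^2\<close>, while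
  \<open>\<beta>\<close> has squared length \<open>2 * \<tau>\<close>; their inner product is
  \<open>- 2 * y\<close>, and Cauchy-Schwarz gives the last bound.\<close>

lemma quartic_sum_of_squares_multiplier:
  fixes \<alpha> \<beta> \<gamma> :: "'a \<Rightarrow> real"
  assumes "\<And>x. (\<Sum>i\<in>I. (\<gamma> i + \<beta> i * x + \<alpha> i * x^2)^2) = x^4 - 4 * y * x + c"
  defines "\<tau> \<equiv> - (\<Sum>i\<in>I. \<alpha> i * \<gamma> i)"
  shows "\<tau> \<ge> 0" "\<tau>^2 \<le> c" "(c - \<tau>^2) * \<tau> \<ge> 2 * y^2"
proof -
  note coeffs = quartic_sum_of_squares_coeffs[OF assms(1)]
  have \<beta>: "(\<Sum>i\<in>I. (\<beta> i)^2) = 2 * \<tau>" using coeffs(3) by (simp add: \<tau>_def)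
  have "(\<Sum>i\<in>I. (\<beta> i)^2) \<ge> 0" by (intro sum_nonneg) simp
  with \<beta> show "\<tau> \<ge> 0" by simp
  have "(\<Sum>i\<in>I. (\<gamma> i + \<tau> * \<alpha> i)^2) =
      (\<Sum>i\<in>I. (\<gamma> i)^2) + 2 * \<tau> * (\<Sum>i\<in>I. \<alpha> i * \<gamma> i) + \<tau>^2 * (\<Sum>i\<in>I. (\<alpha> i)^2)"
    unfolding sum_distrib_left sum.distrib[symmetric] by (intro sum.cong refl) algebra
  also have "\<dots> = c - \<tau>^2" using coeffs(1,5) by (simp add: \<tau>_def power2_eq_square)
  finally have \<gamma>: "(\<Sum>i\<in>I. (\<gamma> i + \<tau> * \<alpha> i)^2) = c - \<tau>^2" .
  have "(\<Sum>i\<in>I. (\<gamma> i + \<tau> * \<alpha> i)^2) \<ge> 0" by (intro sum_nonneg) simp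
  with \<gamma> show "\<tau>^2 \<le> c" by simp
  have "(\<Sum>i\<in>I. \<beta> i * (\<gamma> i + \<tau> * \<alpha> i)) = (\<Sum>i\<in>I. \<beta> i * \<gamma> i) + \<tau> * (\<Sum>i\<in>I. \<alpha> i * \<beta> i)"
    unfolding sum_distrib_left sum.distrib[symmetric] by (intro sum.cong refl) algebra
  also have "\<dots> = - 2 * y" using coeffs(2,4) by simp
  finally have "(- 2 * y)^2 \<le> (\<Sum>i\<in>I. (\<beta> i)^2) * (\<Sum>i\<in>I. (\<gamma> i + \<tau> * \<alpha> i)^2)"
    using Cauchy_Schwarz_ineq_sum by metis
  then show "(c - \<tau>^2) * \<tau> \<ge> 2 * y^2" unfolding \<beta> \<gamma> by (simp add: power_mult_distrib algebra_simps)
qed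

text \<open>Zero in all further coordinates, so that a decomposition in any number of variables
  restricts to the plane.\<close>

definition plane_point :: "real \<Rightarrow> real \<Rightarrow> nat \<Rightarrow> real" where
  "plane_point x w = (\<lambda>k. if k = 0 then x else if k = 1 then w else 0)"

lemma plane_point_lines:
  "(\<lambda>k. plane_point x 0 k + r * plane_point 0 1 k) = plane_point x r"
  "(\<lambda>k. plane_point 0 w k + r * plane_point 1 0 k) = plane_point r w"
  by (auto simp: plane_point_def)

text \<open>For fixed \<open>w\<close> the square of each summand is bounded by a quartic in
  \<open>x\<close>, so the summand is quadratic in \<open>x\<close>. Its coefficients are polynomial
  in \<open>w\<close>, hence so is the multiplier \<open>\<tau>\<close>, and
  \<open>\<tau>^2 \<le> S\<close> bounds its degree.\<close>

lemma not_sos_bivariate: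
  assumes no_\<tau>: "\<not> (\<exists>\<tau>::real poly. degree \<tau> \<le> degree S \<and> (\<forall>w. poly \<tau> w \<ge> 0 \<and>
     (poly \<tau> w)^2 \<le> poly S w \<and> (poly S w - (poly \<tau> w)^2) * poly \<tau> w \<ge> 2 * (1 + 3*w)^2))"
    and p: "\<And>x w. mpoly_eval p (plane_point x w) = x^4 - 4 * (1 + 3*w) * x + poly S w"
  shows "\<not> sos n p"
proof
  assume "sos n p"
  then obtain m :: nat and q :: "nat \<Rightarrow> mpoly" where pq: "p = (\<Sum>i<m. (q i)\<^sup>2)"
    by (auto simp: sos_def)
  define F where "F i x w = mpoly_eval (q i) (plane_point x w)" for i :: nat and x w
  have sum: "(\<Sum>i<m. (F i x w)^2) = x^4 - 4 * (1 + 3*w) * x + poly S w" for x w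
    using p[of x w] by (simp add: pq mpoly_eval_sos F_def)
  have "\<exists>P :: real poly. \<forall>w. F i x w = poly P w" for i x
    using mpoly_eval_line_poly[of "q i" "plane_point x 0" "plane_point 0 1"]
    by (simp add: F_def plane_point_lines)
  then obtain G :: "nat \<Rightarrow> real \<Rightarrow> real poly" where G: "\<And>i x w. F i x w = poly (G i x) w" by metis
  define \<alpha> where "\<alpha> i w = (F i 1 w + F i (-1) w - 2 * F i 0 w) / 2" for i w
  define \<beta> where "\<beta> i w = (F i 1 w - F i (-1) w) / 2" for i w
  have F: "F i x w = F i 0 w + \<beta> i w * x + \<alpha> i w * x^2" if i: "i < m" for i x w
  proof -
    obtain P :: "real poly" where P: "\<And>x. F i x w = poly P x"
      using mpoly_eval_line_poly[of "q i" "plane_point 0 w" "plane_point 1 0"]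
      by (auto simp: F_def plane_point_lines)
    have "(poly P x)^2 \<le> poly [:poly S w, -4 * (1 + 3*w), 0, 0, 1:] x" for x
    proof -
      have "(poly P x)^2 \<le> (\<Sum>i<m. (F i x w)^2)"
        unfolding P[symmetric] using i by (intro member_le_sum) auto
      also have "\<dots> = poly [:poly S w, -4 * (1 + 3*w), 0, 0, 1:] x"
        unfolding sum by (simp add: algebra_simps power_numeral_reduce)
      finally show ?thesis .
    qed
    then have "2 * degree P \<le> degree [:poly S w, -4 * (1 + 3*w), 0, 0, 1:]" by (rule degree_le_if_square_le)
    then have "degree P \<le> 2" by simp
    then show ?thesis using degree_2_interpolation[of P x] unfolding P \<alpha>_def \<beta>_def by simp
  qed
  define \<tau> :: "real poly" where
    "\<tau> = - (\<Sum>i<m. smult (1/2) (G i 1 + G i (-1) - 2 * G i 0) * G i 0)"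
  have \<tau>: "poly \<tau> w = - (\<Sum>i<m. \<alpha> i w * F i 0 w)" for w
    by (simp add: \<tau>_def poly_sum \<alpha>_def G)
  have "(\<Sum>i<m. (F i 0 w + \<beta> i w * x + \<alpha> i w * x^2)^2) = x^4 - 4 * (1 + 3*w) * x + poly S w" for x w
    unfolding sum[symmetric] by (intro sum.cong refl) (metis F lessThan_iff)
  note \<tau>_props = quartic_sum_of_squares_multiplier[OF this, folded \<tau>]
  have "degree \<tau> \<le> degree S" using degree_le_if_square_le[OF \<tau>_props(2)] by simp
  with \<tau>_props no_\<tau> show False by blast
qed

lemma ex_spq_bivariate:
  assumes n: "n \<ge> 2" and d: "d \<ge> 6" "even d"
  shows "N_SPQ n d - Sigma_SPQ n d \<noteq> {}"
proof -
  obtain e where e: "d = 6 + e" using d(1) le_Suc_ex by blast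
  obtain \<epsilon> :: real where \<epsilon>: "\<epsilon> > 0" and no_\<tau>: "\<not> (\<exists>\<tau>::real poly. degree \<tau> \<le> d \<and> (\<forall>w. poly \<tau> w \<ge> 0 \<and>
     (poly \<tau> w)^2 \<le> sextic w + \<epsilon> * w^(6+e) \<and>
     (sextic w + \<epsilon> * w^(6+e) - (poly \<tau> w)^2) * poly \<tau> w \<ge> 2 * (1 + 3*w)^2))"
    using no_polynomial_multiplier by blast
  define S where "S = [:3, 12, 6, -4, 5, -8, 685545:] + monom \<epsilon> d"
  have S: "poly S w = sextic w + \<epsilon> * w^(6+e)" for w
    by (simp add: S_def sextic_def poly_monom e algebra_simps power_numeral_reduce)
  have "degree S \<le> d" unfolding S_def using d by (intro degree_add_le) (auto simp: degree_monom_le)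
  moreover have "coeff S d > 0"
  proof (cases "d = 6")
    case True
    then show ?thesis using \<epsilon> by (simp add: S_def numeral_eq_Suc)
  next
    case False
    then have "coeff [:3, 12, 6, -4, 5, -8, 685545::real:] d = 0" using d by (intro coeff_eq_0) simp
    then show ?thesis using \<epsilon> by (simp add: S_def)
  qed
  ultimately have degS: "degree S = d" by (simp add: le_degree antisym)
  define s :: "nat \<Rightarrow> real poly" where
    "s i = (if i = 0 then [:0, -4, 0, 0, 1:] else if i = 1 then S else 0)" for i
  define q where "q = product_term 0 1 (-12)"
  have q: "q \<in> mpolys n" "total_degree q \<le> 2"
    using n by (simp_all add: q_def product_term_mpolys total_degree_product_term)
  define p where "p = (\<Sum>i<n. in_variable i (s i)) + q"
  have degs: "\<And>i. degree (s i) \<le> d" using d degS by (simp add: s_def)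
  have 1: "1 < n" "degree (s 1) = d" using n degS by (simp_all add: s_def)
  have "d > 2" using d by simp
  note c = spq_construction[OF q this degs 1 p_def]
  have eval: "mpoly_eval p x = (x 0)^4 - 4 * (1 + 3 * x 1) * x 0 + poly S (x 1)" for x
  proof -
    have "(\<Sum>i<n. poly (s i) (x i)) = (\<Sum>i\<in>{0, 1}. poly (s i) (x i))"
      using n by (intro sum.mono_neutral_right) (auto simp: s_def)
    then show ?thesis
      unfolding c(4) by (simp add: q_def mpoly_eval_product_term s_def algebra_simps power_numeral_reduce)
  qed
  have "nonneg_poly p"
    unfolding nonneg_poly_def
  proof
    fix x :: "nat \<Rightarrow> real"
    have "0 \<le> \<epsilon> * x 1 ^ d" using \<epsilon> d by (simp add: zero_le_even_power)
    then show "mpoly_eval p x \<ge> 0"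
      using bivariate_nonneg[of "x 0" "x 1"] unfolding eval S e by (simp add: mult_ac)
  qed
  moreover have "\<not> sos n p"
    by (rule not_sos_bivariate[of S]) (use no_\<tau> in \<open>simp_all add: degS S eval plane_point_def\<close>)
  ultimately have "p \<in> N_SPQ n d - Sigma_SPQ n d" using c(1-3) by (simp add: N_SPQ_def Sigma_SPQ_def)
  then show ?thesis by blast
qed

section \<open>Three variables\<close>

text \<open>The zeros (2, 2, -3) and (-2, -2, 3) lie in the first case, whose identity is tight
  there with \<open>m = h^2\<close>; the other two cases leave a slack of 15. In the third,
  \<open>m \<le> u^2 / 4\<close> gives \<open>u^2 < 28 / 3\<close>, so \<open>u^2 - 7\<close> is
  below 3.\<close>

lemma trivariate_nonneg_aux:
  fixes x y z :: real
  assumes "x * y \<ge> 0"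
  shows "x^4 + y^4 + z^4 - 2 * (x^2 + y^2 + z^2) + 24 * (x*y + y*z + x*z) + 113 \<ge> 0" (is "?p \<ge> 0")
proof -
  define u m where "u = x + y" and "m = x * y"
  have m: "0 \<le> m" "m \<le> u^2 / 4"
    using assms zero_le_power2[of "x - y"] by (simp_all add: u_def m_def power2_eq_square algebra_simps)
  consider "56 + 4 * m \<le> 7 * u^2" | "u^2 \<le> 7" | "7 < u^2" "7 * u^2 < 56 + 4 * m" by linarith
  then show ?thesis
  proof cases
    case 1
    define h where "h = u / 2"
    have "?p = 2 * (h^2 - 4)^2 + (z^2 - 9)^2 + 4 * (3*h + 2*z)^2 + (m - h^2) * (2*m - 14 * h^2 + 28)"
    proof -
      have "x = 2 * h - y" by (simp add: h_def u_def field_simps)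
      show ?thesis unfolding m_def \<open>x = 2 * h - y\<close> by algebra
    qed
    moreover have "(m - h^2) * (2*m - 14 * h^2 + 28) \<ge> 0"
      using 1 m by (intro mult_nonpos_nonpos) (auto simp: h_def power_divide)
    ultimately show ?thesis by (simp only:) simp
  next
    case 2
    have "?p = (u^2 - 7)^2 + (z^2 - 7)^2 + 12 * (u + z)^2 + 15 + (2 * m^2 + m * (28 - 4 * u^2))"
      unfolding u_def m_def by algebra
    moreover have "m * (28 - 4 * u^2) \<ge> 0" using 2 m by (intro mult_nonneg_nonneg) auto
    ultimately show ?thesis by (simp only:) simp
  next
    case 3
    have "?p = 2 * (m - u^2 + 7)^2 + (z^2 - 7)^2 + 12 * (u + z)^2 + (15 - (u^2 - 7)^2)"
      unfolding u_def m_def by algebra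
    moreover have "(u^2 - 7)^2 \<le> 3^2" using 3 m by (intro power_mono) auto
    ultimately show ?thesis by (simp only:) simp
  qed
qed

text \<open>Some two of three reals have a nonnegative product, and the polynomial is
  symmetric.\<close>

lemma trivariate_nonneg:
  fixes x y z :: real
  shows "x^4 + y^4 + z^4 - 2 * (x^2 + y^2 + z^2) + 24 * (x*y + y*z + x*z) + 113 \<ge> 0"
proof -
  have "x * y \<ge> 0 \<or> y * z \<ge> 0 \<or> x * z \<ge> 0" by (auto simp: zero_le_mult_iff)
  then show ?thesis
    using trivariate_nonneg_aux[of x y z] trivariate_nonneg_aux[of y z x] trivariate_nonneg_aux[of x z y]
    by (auto simp: algebra_simps)
qed

definition space_point :: "real \<Rightarrow> real \<Rightarrow> real \<Rightarrow> nat \<Rightarrow> real" where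
  "space_point x y z = (\<lambda>k. if k = 0 then x else if k = 1 then y else if k = 2 then z else 0)"

definition ternary_form :: "(real \<Rightarrow> real \<Rightarrow> real \<Rightarrow> real) \<Rightarrow> bool" where
  "ternary_form T \<longleftrightarrow> (\<exists>u\<^sub>1 u\<^sub>2 u\<^sub>3 w\<^sub>1 w\<^sub>2 w\<^sub>3. \<forall>x y z.
     T x y z = u\<^sub>1 * x^2 + u\<^sub>2 * y^2 + u\<^sub>3 * z^2 + w\<^sub>1 * (y*z) + w\<^sub>2 * (x*z) + w\<^sub>3 * (x*y))"

lemma ternary_form_0: "ternary_form (\<lambda>x y z. 0)"
  unfolding ternary_form_def by (intro exI[of _ 0]) simp

lemma ternary_form_add:
  assumes "ternary_form T" "ternary_form T'"
  shows "ternary_form (\<lambda>x y z. T x y z + T' x y z)"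
proof -
  obtain a b c d e f a' b' c' d' e' f' where
    "\<And>x y z. T x y z = a * x^2 + b * y^2 + c * z^2 + d * (y*z) + e * (x*z) + f * (x*y)"
    "\<And>x y z. T' x y z = a' * x^2 + b' * y^2 + c' * z^2 + d' * (y*z) + e' * (x*z) + f' * (x*y)"
    using assms unfolding ternary_form_def by metis
  then show ?thesis
    unfolding ternary_form_def
    by - (rule exI[of _ "a + a'"], rule exI[of _ "b + b'"], rule exI[of _ "c + c'"],
        rule exI[of _ "d + d'"], rule exI[of _ "e + e'"], rule exI[of _ "f + f'"],
        simp add: algebra_simps)
qed

lemma ternary_form_monomial:
  "ternary_form (\<lambda>x y z. c * (space_point x y z i * space_point x y z j))"
proof -
  \<comment> \<open>Either order of a mixed pair counts; an index above 2 matches no coefficient,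
    and the product is 0.\<close>
  let ?b = "\<lambda>k l. if (i = k \<and> j = l) \<or> (i = l \<and> j = k) then c else 0"
  have cases: "k = 0 \<or> k = 1 \<or> k = 2 \<or> k \<noteq> 0 \<and> k \<noteq> 1 \<and> k \<noteq> 2" for k :: nat by blast
  show ?thesis
    unfolding ternary_form_def
    by (rule exI[of _ "?b 0 0"], rule exI[of _ "?b 1 1"], rule exI[of _ "?b 2 2"],
        rule exI[of _ "?b 1 2"], rule exI[of _ "?b 0 2"], rule exI[of _ "?b 0 1"])
      (use cases[of i] cases[of j] in \<open>elim disjE conjE; simp add: space_point_def power2_eq_square\<close>)
qed

lemma ternary_form_homogeneous_part:
  assumes "finite A" "\<And>m. m \<in> A \<Longrightarrow> monom_degree m = 2"
  shows "ternary_form (\<lambda>x y z. \<Sum>m\<in>A. c m * mono_eval m (space_point x y z))"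
  using assms
proof (induction A rule: finite_induct)
  case empty
  show ?case by (simp add: ternary_form_0)
next
  case (insert m A)
  obtain i j where "\<And>x. mono_eval m x = x i * x j" using mono_eval_degree_2 insert.prems by blast
  then have "ternary_form (\<lambda>x y z. c m * mono_eval m (space_point x y z))"
    using ternary_form_monomial by simp
  then show ?case using insert by (simp add: ternary_form_add)
qed

text \<open>On ternary quartics the combination of point values below is three times the functional
  \<open>- [x\<^sup>4] + 4 [x\<^sup>3y] + 8 [x\<^sup>2y\<^sup>2] - 4 [x\<^sup>2yz]\<close> of the coefficients averaged over permutations of the
  variables. It is determined up to scaling by vanishing on all but one entry of the symmetry-reduced
  Gram matrix.\<close>

lemma dual_functional_nonneg:
  assumes "ternary_form T"
    and "T (-3) 2 2 = t" "T 2 (-3) 2 = t" "T 2 2 (-3) = t"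
  shows "7 * ((T 1 1 0)^2 + (T 1 0 1)^2 + (T 0 1 1)^2) + ((T 1 (-1) 0)^2 + (T 1 0 (-1))^2 + (T 0 1 (-1))^2)
    + (T (-1) 1 1)^2 + (T 1 (-1) 1)^2 + (T 1 1 (-1))^2
    \<ge> 17 * ((T 1 0 0)^2 + (T 0 1 0)^2 + (T 0 0 1)^2) + 3 * (T 1 1 1)^2"
proof -
  obtain a b c d e f where
    T: "\<And>x y z. T x y z = a * x^2 + b * y^2 + c * z^2 + d * (y*z) + e * (x*z) + f * (x*y)"
    using assms(1) unfolding ternary_form_def by metis
  \<comment> \<open>Equality of the three values amounts to
    \<open>a + 2 * d = b + 2 * e = c + 2 * f\<close>; under this constraint the functional is five
    times a square.\<close>
  define s where "s = a + 2 * d"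
  have a: "a = s - 2 * d" by (simp add: s_def)
  have b: "b = s - 2 * e" and c: "c = s - 2 * f"
    using assms(2-4) by (simp_all add: T s_def)
  have "7 * ((T 1 1 0)^2 + (T 1 0 1)^2 + (T 0 1 1)^2) + ((T 1 (-1) 0)^2 + (T 1 0 (-1))^2 + (T 0 1 (-1))^2)
    + (T (-1) 1 1)^2 + (T 1 (-1) 1)^2 + (T 1 1 (-1))^2
    - (17 * ((T 1 0 0)^2 + (T 0 1 0)^2 + (T 0 0 1)^2) + 3 * (T 1 1 1)^2) = 5 * (3 * s - 2 * (d + e + f))^2"
    unfolding T a b c by (simp add: power2_eq_square algebra_simps)
  moreover have "0 \<le> 5 * (3 * s - 2 * (d + e + f))^2" by simp
  ultimately show ?thesis by linarith
qed

lemma coeff_4_square: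
  fixes P :: "real poly"
  assumes "degree P \<le> 2"
  shows "coeff (P^2) 4 = (coeff P 2)^2"
proof -
  have "coeff (P^2) 4 = (\<Sum>i\<le>4. coeff P i * coeff P (4 - i))" by (simp add: power2_eq_square coeff_mult)
  moreover have "coeff P 3 = 0" "coeff P 4 = 0" using assms by (simp_all add: coeff_eq_0)
  ultimately show ?thesis by (simp add: numeral_eq_Suc)
qed

text \<open>The quartic is even, so each summand vanishes at \<open>v\<close> and \<open>-v\<close>
  for every zero \<open>v\<close>. Having degree at most two along rays, its quadratic part at
  \<open>v\<close> is minus its constant term, the same for all zeros, as
  \<open>dual_functional_nonneg\<close> requires.\<close>

lemma not_sos_trivariate:
  assumes p: "\<And>x y z. mpoly_eval p (space_point x y z) =
    x^4 + y^4 + z^4 - 2 * (x^2 + y^2 + z^2) + 24 * (x*y + y*z + x*z) + 113"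
  shows "\<not> sos n p"
proof
  assume "sos n p"
  then obtain m :: nat and q :: "nat \<Rightarrow> mpoly" where pq: "p = (\<Sum>i<m. (q i)\<^sup>2)"
    by (auto simp: sos_def)
  define F where "F i x y z = mpoly_eval (q i) (space_point x y z)" for i :: nat and x y z
  have sum: "(\<Sum>i<m. (F i x y z)^2) =
    x^4 + y^4 + z^4 - 2 * (x^2 + y^2 + z^2) + 24 * (x*y + y*z + x*z) + 113" for x y z
    using p[of x y z] by (simp add: pq mpoly_eval_sos F_def)
  define P where "P i x y z = (\<Sum>k \<in> Poly_Mapping.keys (q i).
     monom (Poly_Mapping.lookup (q i) k * mono_eval k (space_point x y z)) (monom_degree k))" for i x y z
  have P: "poly (P i x y z) r = F i (r*x) (r*y) (r*z)" for i x y z r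
  proof -
    have "space_point (r*x) (r*y) (r*z) = (\<lambda>k. r * space_point x y z k)"
      by (auto simp: space_point_def)
    then show ?thesis using mpoly_eval_scale[of "q i" r "space_point x y z"] by (simp add: F_def P_def)
  qed
  define Q where "Q x y z = [:113, 0, 24 * (x*y + y*z + x*z) - 2 * (x^2 + y^2 + z^2), 0, x^4 + y^4 + z^4:]"
    for x y z :: real
  have PQ: "(\<Sum>i<m. (P i x y z)^2) = Q x y z" for x y z
  proof -
    have "poly (\<Sum>i<m. (P i x y z)^2) r = poly (Q x y z) r" for r
    proof -
      have "poly (\<Sum>i<m. (P i x y z)^2) r = (\<Sum>i<m. (F i (r*x) (r*y) (r*z))^2)"
        by (simp add: poly_sum P)
      also have "\<dots> = poly (Q x y z) r" unfolding sum Q_def by simp algebra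
      finally show ?thesis .
    qed
    then show ?thesis using poly_eq_poly_eq_iff by blast
  qed
  have degP: "degree (P i x y z) \<le> 2" if "i < m" for i x y z
  proof -
    have "(poly (P i x y z) r)^2 \<le> poly (Q x y z) r" for r
    proof -
      have "(poly (P i x y z) r)^2 \<le> (\<Sum>i<m. (poly (P i x y z) r)^2)"
        using that by (intro member_le_sum) auto
      also have "\<dots> = poly (Q x y z) r" unfolding PQ[symmetric] by (simp add: poly_sum)
      finally show ?thesis .
    qed
    then have "2 * degree (P i x y z) \<le> degree (Q x y z)" by (rule degree_le_if_square_le)
    also have "\<dots> \<le> 4" by (simp add: Q_def)
    finally show ?thesis by simp
  qed
  define T where "T i x y z = coeff (P i x y z) 2" for i x y z
  have sumT: "(\<Sum>i<m. (T i x y z)^2) = x^4 + y^4 + z^4" for x y z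
  proof -
    have "(\<Sum>i<m. (T i x y z)^2) = coeff (\<Sum>i<m. (P i x y z)^2) 4"
      unfolding coeff_sum by (intro sum.cong refl) (simp add: T_def coeff_4_square degP)
    then show ?thesis unfolding PQ by (simp add: Q_def numeral_eq_Suc)
  qed
  have form: "ternary_form (T i)" for i
  proof -
    let ?A = "{k \<in> Poly_Mapping.keys (q i). monom_degree k = 2}"
    have "T i = (\<lambda>x y z. \<Sum>k\<in>?A. Poly_Mapping.lookup (q i) k * mono_eval k (space_point x y z))"
      by (intro ext) (auto simp: T_def P_def coeff_sum intro!: sum.mono_neutral_cong_right split: if_splits)
    then show ?thesis by (simp only:) (rule ternary_form_homogeneous_part, auto)
  qed
  have zero: "T i x y z = - F i 0 0 0"
    if i: "i < m" and root: "x^4 + y^4 + z^4 - 2 * (x^2 + y^2 + z^2) + 24 * (x*y + y*z + x*z) + 113 = 0" for i x y z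
  proof -
    have "(\<Sum>i<m. (F i x y z)^2) = 0" "(\<Sum>i<m. (F i (-x) (-y) (-z))^2) = 0"
      using root unfolding sum by simp_all
    then have "F i x y z = 0" "F i (-x) (-y) (-z) = 0"
      using i by (simp_all add: sum_nonneg_eq_0_iff)
    then show ?thesis
      using poly_degree_2[OF degP[OF i, of x y z]] P[of i x y z 1] P[of i x y z "-1"] P[of i x y z 0]
      by (simp add: T_def)
  qed
  define L where "L t = 7 * (t 1 1 0 + t 1 0 1 + t 0 1 1) + (t 1 (-1) 0 + t 1 0 (-1) + t 0 1 (-1))
    + t (-1) 1 1 + t 1 (-1) 1 + t 1 1 (-1) - 17 * (t 1 0 0 + t 0 1 0 + t 0 0 1) - 3 * t 1 1 1"
    for t :: "real \<Rightarrow> real \<Rightarrow> real \<Rightarrow> real"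
  have "0 \<le> (\<Sum>i<m. L (\<lambda>x y z. (T i x y z)^2))"
  proof (intro sum_nonneg)
    fix i assume "i \<in> {..<m}"
    then show "0 \<le> L (\<lambda>x y z. (T i x y z)^2)"
      using dual_functional_nonneg[OF form[of i], of "- F i 0 0 0"] zero[of i] by (simp add: L_def)
  qed
  also have "\<dots> = L (\<lambda>x y z. \<Sum>i<m. (T i x y z)^2)"
    by (simp add: L_def sum.distrib sum_subtractf sum_distrib_left)
  \<comment> \<open>The point values add up to \<open>42 + 6 + 9 - 51 - 9\<close>.\<close>
  also have "\<dots> = -3" by (simp add: sumT L_def)
  finally show False by simp
qed

lemma ex_spq_trivariate:
  assumes n: "n \<ge> 3"
  shows "N_SPQ n 4 - Sigma_SPQ n 4 \<noteq> {}"
proof -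
  define s :: "nat \<Rightarrow> real poly" where
    "s i = (if i = 0 then [:113, 0, -2, 0, 1:] else if i < 3 then [:0, 0, -2, 0, 1:] else 0)" for i
  define cross where "cross i j = product_term i j 24" for i j
  have cross: "cross i j \<in> mpolys n" "total_degree (cross i j) \<le> 2" if "i < n" "j < n" for i j
    using that by (simp_all add: cross_def product_term_mpolys total_degree_product_term)
  define q where "q = cross 0 1 + cross 1 2 + cross 0 2"
  have q: "q \<in> mpolys n" "total_degree q \<le> 2"
    using n by (simp_all add: q_def cross mpolys_add total_degree_add_le)
  define p where "p = (\<Sum>i<n. in_variable i (s i)) + q"
  have degs: "\<And>i. degree (s i) \<le> 4" by (simp add: s_def)
  have 0: "0 < n" "degree (s 0) = 4" using n by (simp_all add: s_def)
  have "(4::nat) > 2" by simp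
  note c = spq_construction[OF q this degs 0 p_def]
  have eval: "mpoly_eval p x = (x 0)^4 + (x 1)^4 + (x 2)^4 - 2 * ((x 0)^2 + (x 1)^2 + (x 2)^2)
     + 24 * (x 0 * x 1 + x 1 * x 2 + x 0 * x 2) + 113" for x
  proof -
    have "(\<Sum>i<n. poly (s i) (x i)) = (\<Sum>i\<in>{0, 1, 2}. poly (s i) (x i))"
      using n by (intro sum.mono_neutral_right) (auto simp: s_def)
    then show ?thesis
      unfolding c(4)
      by (simp add: q_def cross_def mpoly_eval_add mpoly_eval_product_term s_def algebra_simps power_numeral_reduce)
  qed
  have "nonneg_poly p" unfolding nonneg_poly_def eval using trivariate_nonneg by blast
  moreover have "\<not> sos n p" by (rule not_sos_trivariate) (simp add: eval space_point_def)
  ultimately have "p \<in> N_SPQ n 4 - Sigma_SPQ n 4" using c(1-3) by (simp add: N_SPQ_def Sigma_SPQ_def)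
  then show ?thesis by blast
qed

theorem theorem3p4:
  fixes n d :: nat
  assumes "n > 0" and "d > 0" and "even d"
    and "(n \<ge> 2 \<and> d \<ge> 6) \<or> (n \<ge> 3 \<and> d \<ge> 4)"
  shows "N_SPQ n d - Sigma_SPQ n d \<noteq> {}"
proof (cases "d = 4")
  case True
  then show ?thesis using assms ex_spq_trivariate by auto
next
  case False
  \<comment> \<open>By parity every degree other than 4 is at least 6, so two variables suffice even
    when \<open>n \<ge> 3\<close>.\<close>
  moreover have "d \<noteq> 5" using assms(3) by auto
  ultimately have "n \<ge> 2" "d \<ge> 6" using assms(4) by auto
  then show ?thesis using assms(3) by (rule ex_spq_bivariate)
qed

end
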